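(* Let $m,n,p$ be positive integers. For each $j\in[p]$, let $f_j:\{0,1\}^n\to\mathbb{R}_+$ be a nonnegative submodular function, let $\mathbb{K}_j\subseteq\mathbb{R}^{k_j}$ be a closed convex pointed cone, and let $A^j\in\mathbb{R}^{k_j\times m}$, $B^j\in\mathbb{R}^{k_j}$. Define $$\mathcal{S}=\left\{(x,z)\in\mathbb{R}^{mp}\times\{0,1\}^n:\ \exists y\in\mathbb{R}^p\text{ s.t. } y_j\ge f_j(z)\ \text{ and }\ A^jx^j+B^jy_j\in\mathbb{K}_j\ \ \forall j\in[p]\right\},$$ $$\mathcal{G}=\left\{(y,z)\in\mathbb{R}^p\times\{0,1\}^n:\ y_j\ge f_j(z)\ \ \forall j\in[p]\right\},$$ $$\widehat{\mathcal{S}}=\left\{(x,z)\in\mathbb{R}^{mp}\times[0,1]^n:\ \exists y\in\mathbb{R}^p\text{ s.t. }(y,z)\in\operatorname{conv}(\mathcal{G})\ \text{ and }\ A^jx^j+B^jy_j\in\mathbb{K}_j\ \ \forall j\in[p]\right\}.$$ Then $\operatorname{conv}(\mathcal{S})=\widehat{\mathcal{S}}$, and moreover $$\widehat{\mathcal{S}}=\left\{(x,z)\in\mathbb{R}^{mp}\times[0,1]^n:\ \exists y\in\mathbb{R}^p\text{ s.t. }(y_j,z)\in\operatorname{conv}(\operatorname{epi}(f_j))\ \text{ and }\ A^jx^j+B^jy_j\in\mathbb{K}_j\ \ \forall j\in[p]\right\}.$$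
   Context: $[p]=\{1,\dots,p\}$. A vector $x\in\mathbb{R}^{mp}$ is partitioned as $x=(x^1,\dots,x^p)$ with $x^j\in\mathbb{R}^m$; $y=(y_1,\dots,y_p)\in\mathbb{R}^p$. A function $f:\{0,1\}^n\to\mathbb{R}$ is identified with the set function $f(V)=f(\mathbf{1}_V)$, $V\subseteq[n]$, where $\mathbf{1}_V$ is the characteristic vector of $V$; it is submodular if $f(S_1)+f(S_2)\ge f(S_1\cup S_2)+f(S_1\cap S_2)$ for all $S_1,S_2\subseteq[n]$. $\operatorname{epi}(f)=\{(y,z)\in\mathbb{R}\times\{0,1\}^n:\ y\ge f(z)\}$, and $\operatorname{conv}$ denotes the convex hull. A closed convex cone is pointed if it contains no line, i.e. $\mathbb{K}\cap(-\mathbb{K})=\{0\}$. *)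

theory Defs
  imports "HOL-Analysis.Analysis"
begin

text \<open>
  \<open>[m]\<close>, \<open>[n]\<close>, \<open>[p]\<close> are finite index types \<open>'m\<close>, \<open>'n\<close>, \<open>'p\<close>;
  \<open>x :: real^'m^'p\<close> has blocks \<open>x $ j :: real^'m\<close>.
\<close>

definition binary_cube :: "(real^'n) set"
  where "binary_cube = {z. \<forall>i. z $ i \<in> {0, 1}}"

definition unit_cube :: "(real^'n) set"
  where "unit_cube = {z. \<forall>i. 0 \<le> z $ i \<and> z $ i \<le> 1}"

definition char_vec :: "'n set \<Rightarrow> real^'n"
  where "char_vec V = (\<chi> i. if i \<in> V then 1 else 0)"

text \<open>
  A function on \<open>{0,1}\<^sup>n\<close> is a total function on \<open>real^'n\<close> whose values outside
  \<^const>\<open>binary_cube\<close> are never used.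
\<close>

definition submodular :: "(real^'n \<Rightarrow> real) \<Rightarrow> bool"
  where "submodular f \<longleftrightarrow>
    (\<forall>S T. f (char_vec S) + f (char_vec T) \<ge> f (char_vec (S \<union> T)) + f (char_vec (S \<inter> T)))"

text \<open>The value comes first here, unlike in the library's \<^const>\<open>epigraph\<close>.\<close>

definition epi :: "(real^'n \<Rightarrow> real) \<Rightarrow> (real \<times> (real^'n)) set"
  where "epi f = {(y, z). z \<in> binary_cube \<and> y \<ge> f z}"

text \<open>
  The ambient spaces \<open>\<real>\<^bsup>k j\<^esup>\<close> may have different dimensions for different \<open>j\<close>.
  All of them are realized inside one \<open>real^'k\<close>, as coordinate subspaces
  \<open>coord_space (I j)\<close> with \<open>card (I j) = k j\<close>; since \<open>'p\<close> is finite, every family of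
  dimensions arises in this way for a large enough \<open>'k\<close>. Coordinate subspaces are closed, so being closed
  in \<open>coord_space (I j)\<close> and being closed in \<open>real^'k\<close> agree for subsets of
  \<open>coord_space (I j)\<close>. A \<open>k j \<times> m\<close> matrix is one whose rows outside \<open>I j\<close> vanish.
\<close>

definition coord_space :: "'k set \<Rightarrow> (real^'k) set"
  where "coord_space I = {v. \<forall>i. i \<notin> I \<longrightarrow> v $ i = 0}"

definition coord_matrices :: "'k set \<Rightarrow> (real^'m^'k) set"
  where "coord_matrices I = {M. \<forall>i. i \<notin> I \<longrightarrow> M $ i = 0}"

text \<open>
  The library's \<^const>\<open>cone\<close> (closed under multiplication by all \<open>c \<ge> 0\<close>) admits the empty
  set; the last conjunct excludes it.
\<close>

definition closed_convex_pointed_cone :: "'a::real_normed_vector set \<Rightarrow> bool"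
  where "closed_convex_pointed_cone K \<longleftrightarrow>
    closed K \<and> convex K \<and> cone K \<and> K \<inter> uminus ` K = {0}"

definition conic_constraints ::
  "('p \<Rightarrow> real^'m^'k) \<Rightarrow> ('p \<Rightarrow> real^'k) \<Rightarrow> ('p \<Rightarrow> (real^'k) set) \<Rightarrow> real^'m^'p \<Rightarrow> real^'p \<Rightarrow> bool"
  where "conic_constraints A B K x y \<longleftrightarrow> (\<forall>j. A j *v (x $ j) + (y $ j) *\<^sub>R B j \<in> K j)"

definition set_S ::
  "('p \<Rightarrow> real^'n \<Rightarrow> real) \<Rightarrow> ('p \<Rightarrow> real^'m^'k) \<Rightarrow> ('p \<Rightarrow> real^'k) \<Rightarrow> ('p \<Rightarrow> (real^'k) set)
    \<Rightarrow> ((real^'m^'p) \<times> (real^'n)) set"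
  where "set_S f A B K =
    {(x, z). z \<in> binary_cube \<and>
      (\<exists>y :: real^'p. (\<forall>j. y $ j \<ge> f j z) \<and> conic_constraints A B K x y)}"

definition set_G :: "('p \<Rightarrow> real^'n \<Rightarrow> real) \<Rightarrow> ((real^'p) \<times> (real^'n)) set"
  where "set_G f = {(y, z). z \<in> binary_cube \<and> (\<forall>j. y $ j \<ge> f j z)}"

definition set_Shat ::
  "('p \<Rightarrow> real^'n \<Rightarrow> real) \<Rightarrow> ('p \<Rightarrow> real^'m^'k) \<Rightarrow> ('p \<Rightarrow> real^'k) \<Rightarrow> ('p \<Rightarrow> (real^'k) set)
    \<Rightarrow> ((real^'m^'p) \<times> (real^'n)) set"
  where "set_Shat f A B K =
    {(x, z). z \<in> unit_cube \<and>
      (\<exists>y :: real^'p. (y, z) \<in> convex hull (set_G f) \<and> conic_constraints A B K x y)}"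

end

theory Submission imports Defs begin

text \<open>
  For the first equality, \<open>conv S\<close> lies in the relaxation because the latter is convex, the cones
  being convex. Conversely, a point \<open>(y, z)\<close> of \<open>conv G\<close> is a convex combination of points
  \<open>(y\<^sup>v, v)\<close> of \<open>G\<close>. Each block \<open>x\<^sup>j\<close> is distributed over these points in proportion to
  \<open>y\<^sup>v\<^sub>j\<close>, that is, as \<open>(y\<^sup>v\<^sub>j / y\<^sub>j) x\<^sup>j\<close>. Then the vector \<open>A\<^sup>j x\<^sup>j + B\<^sup>j y\<^sub>j\<close> is only rescaled by a
  nonnegative factor, so it stays in the cone. If \<open>y\<^sub>j = 0\<close>, nonnegativity of the \<open>f\<^sub>j\<close>
  forces all \<open>y\<^sup>v\<^sub>j\<close> with positive weight to vanish, and \<open>x\<^sup>j\<close> is kept unchanged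
  (\<open>hull_G_imp_hull_S\<close>).

  The second equality says that \<open>(y, z) \<in> conv G\<close> exactly when
  \<open>(y\<^sub>j, z) \<in> conv (epi f\<^sub>j)\<close> for all \<open>j\<close>. The nontrivial half uses the description of the
  convex envelope of a submodular function by its Lovasz extension. Sort the coordinates of \<open>z\<close>
  decreasingly. The prefixes of this order form a chain of sets, and \<open>z\<close> is a convex
  combination of their characteristic vectors with weights that depend on \<open>z\<close> alone
  (\<open>chain_decomposition\<close>). For every submodular function, the greedy algorithm produces an affine
  minorant that is tight on the whole chain (\<open>greedy_minorant\<close>). Hence the same weights give the
  smallest possible value over \<open>z\<close> for all \<open>f\<^sub>j\<close> at once, and shifting the values on the chain
  upwards by the common slack writes \<open>(y, z)\<close> as a convex combination of points of \<open>G\<close>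
  (\<open>hull_epi_imp_hull_G\<close>).
\<close>

section \<open>Binary vectors and convex combinations\<close>

lemma binary_cube_eq_range_char_vec: "binary_cube = range char_vec"
proof (intro equalityI subsetI)
  fix z :: "real^'n" assume "z \<in> binary_cube"
  then have "z = char_vec {i. z $ i = 1}"
    by (auto simp: binary_cube_def char_vec_def vec_eq_iff)
  then show "z \<in> range char_vec" by blast
qed (auto simp: binary_cube_def char_vec_def)

text \<open>
  Points of weight zero are discarded because a weighted sum of nonnegative numbers that vanishes
  says nothing about them.
\<close>

lemma convex_hull_positive_weights:
  assumes "x \<in> convex hull S"
  obtains T u where "finite T" "T \<subseteq> S" "\<And>v. v \<in> T \<Longrightarrow> 0 < u v" "sum u T = (1::real)"
    "(\<Sum>v\<in>T. u v *\<^sub>R v) = x"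
proof -
  obtain T u where T: "finite T" "T \<subseteq> S" "\<forall>v\<in>T. 0 \<le> u v" "sum u T = (1::real)"
    "(\<Sum>v\<in>T. u v *\<^sub>R v) = x"
    using assms unfolding convex_hull_explicit by auto
  define T' where "T' = {v\<in>T. u v \<noteq> 0}"
  have "sum u T' = sum u T" "(\<Sum>v\<in>T'. u v *\<^sub>R v) = (\<Sum>v\<in>T. u v *\<^sub>R v)"
    by (rule sum.mono_neutral_left; use T in \<open>auto simp: T'_def\<close>)+
  moreover have "0 < u v" if "v \<in> T'" for v
    using that T(3) by (auto simp: T'_def less_le)
  ultimately show thesis
    using T by (intro that[of T' u]) (auto simp: T'_def)
qed

section \<open>Splitting a conic constraint over a convex combination\<close>

text \<open>
  The scaling factors of a block average to \<open>1\<close>, so the scaled blocks average to \<open>x\<close>, although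
  different blocks are distributed in different proportions.
\<close>

lemma hull_G_imp_hull_S:
  fixes f :: "'p::finite \<Rightarrow> real^'n::finite \<Rightarrow> real"
    and A :: "'p \<Rightarrow> real^'m::finite^'k::finite" and x :: "real^'m^'p"
  assumes nonneg: "\<And>j z. z \<in> binary_cube \<Longrightarrow> 0 \<le> f j z"
    and K: "\<And>j. cone (K j)"
    and yz: "(y, z) \<in> convex hull (set_G f)"
    and xy: "conic_constraints A B K x y"
  shows "(x, z) \<in> convex hull (set_S f A B K)"
proof -
  obtain T u where T: "finite T" "T \<subseteq> set_G f" "\<And>v. v \<in> T \<Longrightarrow> 0 < u v" "sum u T = (1::real)"
    and comb: "(\<Sum>v\<in>T. u v *\<^sub>R v) = (y, z)"
    using convex_hull_positive_weights[OF yz] by blast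
  have y: "(\<Sum>v\<in>T. u v * fst v $ j) = y $ j" for j
    using arg_cong[OF comb, of "\<lambda>v. fst v $ j"] by (simp add: fst_sum)
  have z: "(\<Sum>v\<in>T. u v *\<^sub>R snd v) = z"
    using arg_cong[OF comb, of snd] by (simp add: snd_sum)
  have ge: "0 \<le> fst v $ j" if "v \<in> T" for v j
    using that T(2) nonneg[of "snd v" j] by (force simp: set_G_def intro: order_trans)
  have y0: "0 \<le> y $ j" for j
    unfolding y[symmetric] using T(3) ge by (auto intro!: sum_nonneg simp: less_imp_le)
  \<comment> \<open>The factor by which the block \<open>x $ j\<close> is scaled at the point \<open>v\<close>. The value \<open>1\<close> in the
    degenerate case lets the block contribute a recession direction at every point.\<close>
  define r where "r v j = (if y $ j = 0 then 1 else fst v $ j / y $ j)"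
    for v :: "(real^'p) \<times> (real^'n)" and j
  have r_mult: "r v j * y $ j = fst v $ j" if "v \<in> T" for v j
  proof (cases "y $ j = 0")
    case True
    then have "\<forall>v\<in>T. u v * fst v $ j = 0"
      using y[of j] T(1,3) ge
      by (intro iffD1[OF sum_nonneg_eq_0_iff]) (auto simp: less_imp_le)
    then have "fst v $ j = 0" using T(3)[OF that] that by auto
    with True show ?thesis by simp
  qed (simp add: r_def)
  have r_ge: "0 \<le> r v j" if "v \<in> T" for v j
    using ge[OF that] y0 by (simp add: r_def)
  have r_sum: "(\<Sum>v\<in>T. u v * r v j) = 1" for j
  proof (cases "y $ j = 0")
    case False
    then show ?thesis
      using y[of j] by (simp add: r_def flip: sum_divide_distrib)
  qed (simp add: r_def T(4))
  define h where "h v = ((\<chi> j. r v j *\<^sub>R x $ j) :: real^'m^'p)" for v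
  have "(h v, snd v) \<in> set_S f A B K" if v: "v \<in> T" for v
  proof -
    have "A j *v (h v $ j) + fst v $ j *\<^sub>R B j \<in> K j" for j
    proof -
      have "A j *v (h v $ j) + fst v $ j *\<^sub>R B j = r v j *\<^sub>R (A j *v (x $ j) + y $ j *\<^sub>R B j)"
        by (simp add: h_def r_mult[OF v, symmetric] scaleR_add_right matrix_vector_mult_scaleR)
      also have "\<dots> \<in> K j"
        using K[of j] xy r_ge[OF v] by (auto simp: conic_constraints_def cone_def)
      finally show ?thesis .
    qed
    then show ?thesis
      using v T(2) by (auto simp: set_S_def set_G_def conic_constraints_def intro!: exI[of _ "fst v"])
  qed
  then have "(\<Sum>v\<in>T. u v *\<^sub>R (h v, snd v)) \<in> convex hull (set_S f A B K)"
    using T by (intro convex_sum) (auto intro: hull_inc less_imp_le)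
  moreover have "(\<Sum>v\<in>T. u v *\<^sub>R h v) = x"
    by (simp add: vec_eq_iff h_def mult.assoc[symmetric] r_sum flip: sum_distrib_right)
  ultimately show ?thesis
    using z by (simp add: sum_prod)
qed

lemma set_S_subset_set_Shat: "set_S f A B K \<subseteq> set_Shat f A B K"
  by (auto simp: set_S_def set_Shat_def set_G_def binary_cube_def unit_cube_def
      intro!: hull_inc) (metis order.refl zero_le_one)+

lemma convex_unit_cube: "convex (unit_cube :: (real^'n::finite) set)"
proof -
  have "(unit_cube :: (real^'n) set) = cbox 0 1"
    by (auto simp: unit_cube_def mem_box_cart)
  then show ?thesis by (metis convex_box(1))
qed

lemma convex_set_Shat:
  fixes f :: "'p::finite \<Rightarrow> real^'n::finite \<Rightarrow> real"
    and A :: "'p \<Rightarrow> real^'m::finite^'k::finite"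
  assumes K: "\<And>j. convex (K j)"
  shows "convex (set_Shat f A B K)"
proof (rule convexI)
  fix p q :: "(real^'m^'p) \<times> (real^'n)" and s t :: real
  assume pq: "p \<in> set_Shat f A B K" "q \<in> set_Shat f A B K" and st: "0 \<le> s" "0 \<le> t" "s + t = 1"
  obtain x z where p: "p = (x, z)" by fastforce
  obtain x' z' where q: "q = (x', z')" by fastforce
  from pq p q obtain y y' where
    z: "z \<in> unit_cube" "z' \<in> unit_cube" and
    y: "(y, z) \<in> convex hull (set_G f)" "(y', z') \<in> convex hull (set_G f)" and
    xy: "conic_constraints A B K x y" "conic_constraints A B K x' y'"
    by (auto simp: set_Shat_def)
  have "s *\<^sub>R z + t *\<^sub>R z' \<in> unit_cube"
    using convexD[OF convex_unit_cube] z st by blast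
  moreover have "(s *\<^sub>R y + t *\<^sub>R y', s *\<^sub>R z + t *\<^sub>R z') \<in> convex hull (set_G f)"
    using convexD[OF convex_convex_hull y st] by simp
  moreover have "conic_constraints A B K (s *\<^sub>R x + t *\<^sub>R x') (s *\<^sub>R y + t *\<^sub>R y')"
    unfolding conic_constraints_def
  proof
    fix j
    have "s *\<^sub>R (A j *v (x $ j) + y $ j *\<^sub>R B j) + t *\<^sub>R (A j *v (x' $ j) + y' $ j *\<^sub>R B j) \<in> K j"
      using xy by (intro convexD[OF K _ _ st]) (auto simp: conic_constraints_def)
    also have "s *\<^sub>R (A j *v (x $ j) + y $ j *\<^sub>R B j) + t *\<^sub>R (A j *v (x' $ j) + y' $ j *\<^sub>R B j)
      = A j *v ((s *\<^sub>R x + t *\<^sub>R x') $ j) + (s *\<^sub>R y + t *\<^sub>R y') $ j *\<^sub>R B j"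
      by (simp add: matrix_vector_right_distrib matrix_vector_mult_scaleR algebra_simps)
    finally show "\<dots> \<in> K j" .
  qed
  ultimately show "s *\<^sub>R p + t *\<^sub>R q \<in> set_Shat f A B K"
    by (auto simp: p q set_Shat_def)
qed

section \<open>The Lovasz extension\<close>

text \<open>
  This is Edmonds' greedy algorithm for the base polytope. Each new element receives its marginal
  value along the list; since that is at most its marginal value over any subset of the earlier
  elements, the resulting modular function stays below \<open>g\<close>.
\<close>

lemma greedy_minorant:
  fixes g :: "'a set \<Rightarrow> real"
  assumes submod: "\<And>S T. g (S \<union> T) + g (S \<inter> T) \<le> g S + g T"
    and "distinct xs"
  shows "\<exists>w. (\<forall>k. g (set (take k xs)) = g {} + sum w (set (take k xs))) \<and>
    (\<forall>S\<subseteq>set xs. g {} + sum w S \<le> g S)"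
  using \<open>distinct xs\<close>
proof (induction xs rule: rev_induct)
  case Nil
  then show ?case by simp
next
  case (snoc a xs)
  then have a: "a \<notin> set xs" by simp
  from snoc obtain w where
    tight: "\<And>k. g (set (take k xs)) = g {} + sum w (set (take k xs))" and
    below: "\<And>S. S \<subseteq> set xs \<Longrightarrow> g {} + sum w S \<le> g S"
    by auto
  define w' where "w' = w(a := g (insert a (set xs)) - g (set xs))"
  have w': "sum w' S = sum w S" if "S \<subseteq> set xs" for S
    using that a by (intro sum.cong) (auto simp: w'_def)
  have w'_ins: "sum w' (insert a S) = sum w S + g (insert a (set xs)) - g (set xs)"
    if "S \<subseteq> set xs" for S
  proof -
    have "finite S" "a \<notin> S" using that a by (auto intro: finite_subset)
    then have "sum w' (insert a S) = w' a + sum w' S" by simp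
    with w'[OF that] show ?thesis by (simp add: w'_def)
  qed
  have "g (set (take k (xs @ [a]))) = g {} + sum w' (set (take k (xs @ [a])))" for k
  proof (cases "k \<le> length xs")
    case True
    then show ?thesis using tight[of k] w'[of "set (take k xs)"] by (simp add: set_take_subset)
  next
    case False
    then have "set (take k (xs @ [a])) = insert a (set xs)" by simp
    then show ?thesis using tight[of "length xs"] w'_ins[of "set xs"] by simp
  qed
  moreover have "g {} + sum w' S \<le> g S" if "S \<subseteq> set (xs @ [a])" for S
  proof (cases "a \<in> S")
    case False
    then have "S \<subseteq> set xs" using that by auto
    then show ?thesis using below w' by simp
  next
    case True
    define S' where "S' = S - {a}"
    have S': "S' \<subseteq> set xs" "S = insert a S'" using that True by (auto simp: S'_def)
    then have "S \<union> set xs = insert a (set xs)" "S \<inter> set xs = S'" using a by auto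
    with submod[of S "set xs"] have "g (insert a (set xs)) + g S' \<le> g S + g (set xs)" by simp
    with below[OF S'(1)] w'_ins[OF S'(1)] S'(2) show ?thesis by simp
  qed
  ultimately show ?case by blast
qed

text \<open>
  The weight of a prefix is the drop of \<open>z\<close> from its last element to the next one; summing the
  drops over the prefixes that contain a given element telescopes to the value of \<open>z\<close> there.
\<close>

lemma chain_decomposition:
  fixes z :: "real^'n::finite"
  assumes z: "z \<in> unit_cube"
  obtains xs :: "'n list" and l :: "nat \<Rightarrow> real" where "distinct xs" "set xs = UNIV"
    "\<And>k. 0 \<le> l k" "sum l {..length xs} = 1"
    "(\<Sum>k\<le>length xs. l k *\<^sub>R char_vec (set (take k xs))) = z"
proof -
  obtain ys :: "'n list" where ys: "set ys = UNIV" "distinct ys"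
    using finite_distinct_list[of "UNIV :: 'n set"] by auto
  define xs where "xs = sort_key (\<lambda>i. - z $ i) ys"
  have xs: "set xs = UNIV" "distinct xs" "sorted (map (\<lambda>i. - z $ i) xs)"
    using ys by (auto simp: xs_def)
  let ?n = "length xs"
  \<comment> \<open>The sorted values of \<open>z\<close>, framed by \<open>1\<close> and \<open>0\<close> so that the weights of the empty and of
    the full prefix are drops as well.\<close>
  define c where "c k = (if k = 0 then 1 else if k \<le> ?n then z $ (xs ! (k - 1)) else 0)" for k
  define l where "l k = c k - c (Suc k)" for k
  have z01: "0 \<le> z $ i" "z $ i \<le> 1" for i using z by (auto simp: unit_cube_def)
  have l0: "0 \<le> l k" for k
  proof -
    have "z $ (xs ! k) \<le> z $ (xs ! (k - 1))" if "k < ?n"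
      using sorted_nth_mono[OF xs(3), of "k - 1" k] that by simp
    then show ?thesis using z01 by (auto simp: l_def c_def Suc_le_eq)
  qed
  have tele: "sum l {m..?n} = c m" if "m \<le> Suc ?n" for m
    using sum_Suc_diff[of m ?n "\<lambda>k. - c k"] that by (simp add: l_def) (simp add: c_def)
  have "(\<Sum>k\<le>?n. l k * char_vec (set (take k xs)) $ i) = z $ i" for i
  proof -
    obtain q where q: "q < ?n" "xs ! q = i" using xs(1) by (metis UNIV_I in_set_conv_nth)
    have mem: "i \<in> set (take k xs) \<longleftrightarrow> q < k" if "k \<le> ?n" for k
      using that q xs(2) by (auto simp: in_set_conv_nth nth_eq_iff_index_eq)
    have "(\<Sum>k\<le>?n. l k * char_vec (set (take k xs)) $ i) = (\<Sum>k\<le>?n. if q < k then l k else 0)"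
      by (intro sum.cong) (auto simp: char_vec_def mem)
    also have "\<dots> = sum l {Suc q..?n}"
      by (subst sum.inter_filter[symmetric]) (auto intro!: sum.cong)
    also have "\<dots> = z $ i" using q tele[of "Suc q"] by (simp add: c_def)
    finally show ?thesis .
  qed
  moreover have "sum l {..?n} = 1"
    using tele[of 0] by (simp add: c_def atMost_atLeast0)
  ultimately show thesis
    using xs l0 by (intro that[of xs l]) (auto simp: vec_eq_iff)
qed

text \<open>
  The affine minorant tight on the chain bounds \<open>conv (epi f)\<close> from below, so no convex
  combination representing \<open>z\<close> can beat the chain.
\<close>

lemma hull_epi_ge_chain_value:
  fixes f :: "real^'n::finite \<Rightarrow> real"
  assumes submod: "submodular f"
    and xs: "distinct xs" "set xs = UNIV"
    and l: "sum l {..length xs} = (1::real)"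
      "(\<Sum>k\<le>length xs. l k *\<^sub>R char_vec (set (take k xs))) = z"
    and y: "(y, z) \<in> convex hull (epi f)"
  shows "(\<Sum>k\<le>length xs. l k * f (char_vec (set (take k xs)))) \<le> y"
proof -
  let ?v = "\<lambda>k. char_vec (set (take k xs)) :: real^'n"
  obtain w where
    tight: "\<And>k. f (?v k) = f (char_vec {}) + sum w (set (take k xs))" and
    below: "\<And>S. f (char_vec {}) + sum w S \<le> f (char_vec S)"
    using greedy_minorant[of "\<lambda>S. f (char_vec S)" xs] submod xs by (auto simp: submodular_def)
  define c where "c = f (char_vec {})"
  define W where "W = ((\<chi> i. w i) :: real^'n)"
  have W: "W \<bullet> char_vec S = sum w S" for S
    by (simp add: W_def char_vec_def inner_vec_def if_distrib sum.If_cases cong: if_cong)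
  have "convex {p. (- 1, W) \<bullet> p \<le> - c}" by (rule convex_halfspace_le)
  moreover have "epi f \<subseteq> {p. (- 1, W) \<bullet> p \<le> - c}"
  proof
    fix p assume "p \<in> epi f"
    then obtain S where "f (char_vec S) \<le> fst p" "snd p = char_vec S"
      by (auto simp: epi_def binary_cube_eq_range_char_vec)
    with below[of S] show "p \<in> {p. (- 1, W) \<bullet> p \<le> - c}"
      by (simp add: inner_prod_def W c_def)
  qed
  ultimately have "convex hull (epi f) \<subseteq> {p. (- 1, W) \<bullet> p \<le> - c}" by (intro hull_minimal)
  with y have "c + W \<bullet> z \<le> y" by auto
  also have "c + W \<bullet> z = (\<Sum>k\<le>length xs. l k * (c + W \<bullet> ?v k))"
    using l by (simp add: distrib_left sum.distrib inner_sum_right flip: l(2) sum_distrib_right)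
  finally show ?thesis using tight by (simp add: W c_def)
qed

section \<open>The joint epigraph is described one component at a time\<close>

text \<open>
  The convex combinations behind the separate hypotheses on the \<open>y $ j\<close> may have unrelated points
  and weights. The chain of \<open>z\<close> replaces them all by one combination that serves every \<open>j\<close>.
\<close>

lemma hull_epi_imp_hull_G:
  fixes f :: "'p::finite \<Rightarrow> real^'n::finite \<Rightarrow> real"
  assumes submod: "\<And>j. submodular (f j)"
    and z: "z \<in> unit_cube"
    and y: "\<And>j. (y $ j, z) \<in> convex hull (epi (f j))"
  shows "(y, z) \<in> convex hull (set_G f)"
proof -
  obtain xs :: "'n list" and l where xs: "distinct xs" "set xs = UNIV"
    and l: "\<And>k. 0 \<le> l k" "sum l {..length xs} = 1"
      "(\<Sum>k\<le>length xs. l k *\<^sub>R char_vec (set (take k xs))) = z"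
    using chain_decomposition[OF z] by blast
  let ?N = "{..length xs}" and ?v = "\<lambda>k. char_vec (set (take k xs)) :: real^'n"
  define F where "F k = ((\<chi> j. f j (?v k)) :: real^'p)" for k
  define slack where "slack = y - (\<Sum>k\<in>?N. l k *\<^sub>R F k)"
  have "0 \<le> slack $ j" for j
    using hull_epi_ge_chain_value[OF submod xs l(2,3) y] by (simp add: slack_def F_def)
  then have "(F k + slack, ?v k) \<in> set_G f" for k
    by (auto simp: set_G_def F_def binary_cube_eq_range_char_vec)
  then have "(\<Sum>k\<in>?N. l k *\<^sub>R (F k + slack, ?v k)) \<in> convex hull (set_G f)"
    using l by (intro convex_sum) (auto intro: hull_inc)
  moreover have "(\<Sum>k\<in>?N. l k *\<^sub>R (F k + slack)) = y"
    using l(2) by (simp add: slack_def scaleR_add_right sum.distrib flip: scaleR_sum_left)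
  ultimately show ?thesis using l(3) by (simp add: sum_prod)
qed

lemma hull_G_imp_hull_epi:
  fixes f :: "'p::finite \<Rightarrow> real^'n \<Rightarrow> real"
  assumes "(y, z) \<in> convex hull (set_G f)"
  shows "(y $ j, z) \<in> convex hull (epi (f j))"
proof -
  define P where "P = (\<lambda>p :: (real^'p) \<times> (real^'n). (fst p $ j, snd p))"
  have "linear P" by (auto simp: P_def linear_iff)
  moreover have "P ` set_G f \<subseteq> epi (f j)" by (auto simp: P_def set_G_def epi_def)
  ultimately have "P ` (convex hull (set_G f)) \<subseteq> convex hull (epi (f j))"
    by (simp add: convex_hull_linear_image hull_mono)
  with assms show ?thesis by (force simp: P_def)
qed

theorem corollary6:
  fixes f :: "'p::finite \<Rightarrow> real^'n::finite \<Rightarrow> real"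
    and I :: "'p \<Rightarrow> 'k::finite set"
    and K :: "'p \<Rightarrow> (real^'k) set"
    and A :: "'p \<Rightarrow> real^'m::finite^'k"
    and B :: "'p \<Rightarrow> real^'k"
  assumes nonneg: "\<And>j z. z \<in> binary_cube \<Longrightarrow> 0 \<le> f j z"
    and submod: "\<And>j. submodular (f j)"
    and K_space: "\<And>j. K j \<subseteq> coord_space (I j)"
    and K_cone: "\<And>j. closed_convex_pointed_cone (K j)"
    and A_space: "\<And>j. A j \<in> coord_matrices (I j)"
    and B_space: "\<And>j. B j \<in> coord_space (I j)"
  shows "convex hull (set_S f A B K) = set_Shat f A B K \<and>
    set_Shat f A B K =
      {(x, z). z \<in> unit_cube \<and>
        (\<exists>y :: real^'p. (\<forall>j. (y $ j, z) \<in> convex hull (epi (f j))) \<and> conic_constraints A B K x y)}"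
proof
  have cone: "cone (K j)" and convex: "convex (K j)" for j
    using K_cone[of j] by (auto simp: closed_convex_pointed_cone_def)
  show "convex hull (set_S f A B K) = set_Shat f A B K"
  proof
    show "convex hull (set_S f A B K) \<subseteq> set_Shat f A B K"
      by (intro hull_minimal set_S_subset_set_Shat convex_set_Shat convex)
    show "set_Shat f A B K \<subseteq> convex hull (set_S f A B K)"
      using hull_G_imp_hull_S[OF nonneg cone] by (auto simp: set_Shat_def)
  qed
  have "(y, z) \<in> convex hull (set_G f) \<longleftrightarrow> (\<forall>j. (y $ j, z) \<in> convex hull (epi (f j)))"
    if "z \<in> unit_cube" for y z
    using hull_epi_imp_hull_G[of f, OF submod that] hull_G_imp_hull_epi[of y z f] by blast
  then show "set_Shat f A B K =
      {(x, z). z \<in> unit_cube \<and>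
        (\<exists>y :: real^'p. (\<forall>j. (y $ j, z) \<in> convex hull (epi (f j))) \<and> conic_constraints A B K x y)}"
    by (auto simp: set_Shat_def)
qed

end
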